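(* For every 3-uniform hypergraph $H$ with $R_2(H)\geq \max\{|V(H)|+1,7\}$, we have $f(H,\mathcal{L})=R_2(H)$.
   Context: For a 3-graph $H$, $R_2(H)$ is the minimum $n$ such that every 2-edge-coloring of $K^{(3)}_n$ contains a monochromatic copy of $H$. The constrained Ramsey number $f(H,G)$ is the minimum $n$ such that every edge-coloring of $K^{(3)}_n$ with any number of colors contains either a monochromatic copy of $H$ or a rainbow copy of $G$. The loose path $\mathcal{L}$ is the 3-graph with vertices $v_1,\ldots,v_7$ and edges $\{v_1v_2v_3,v_3v_4v_5,v_5v_6v_7\}$. *)

theory Defs
  imports "HOL-Library.Ramsey" "HOL-Library.Extended_Nat"
begin

type_synonym 'a hypergraph = "'a set \<times> 'a set set"

abbreviation verts :: "'a hypergraph \<Rightarrow> 'a set" where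
  "verts H \<equiv> fst H"

abbreviation edges :: "'a hypergraph \<Rightarrow> 'a set set" where
  "edges H \<equiv> snd H"

definition three_graph :: "'a hypergraph \<Rightarrow> bool" where
  "three_graph H \<longleftrightarrow> finite (verts H) \<and> edges H \<subseteq> nsets (verts H) 3"

definition K3 :: "nat \<Rightarrow> nat hypergraph" where
  "K3 n = ({..<n}, nsets {..<n} 3)"

text \<open>A copy of \<open>H\<close> in \<open>F\<close> is given by an embedding, i.e. a vertex injection
  that maps edges to edges; the edges of the copy are the images of the edges of \<open>H\<close>.\<close>

definition embedding :: "('a \<Rightarrow> 'b) \<Rightarrow> 'a hypergraph \<Rightarrow> 'b hypergraph \<Rightarrow> bool" where
  "embedding \<phi> H F \<longleftrightarrow>
     inj_on \<phi> (verts H) \<and> \<phi> ` verts H \<subseteq> verts F \<and> (\<forall>e\<in>edges H. \<phi> ` e \<in> edges F)"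

definition has_mono_copy :: "('b set \<Rightarrow> 'c) \<Rightarrow> 'b hypergraph \<Rightarrow> 'a hypergraph \<Rightarrow> bool" where
  "has_mono_copy c F H \<longleftrightarrow> (\<exists>\<phi>. embedding \<phi> H F \<and> (\<exists>k. \<forall>e\<in>edges H. c (\<phi> ` e) = k))"

definition has_rainbow_copy :: "('b set \<Rightarrow> 'c) \<Rightarrow> 'b hypergraph \<Rightarrow> 'a hypergraph \<Rightarrow> bool" where
  "has_rainbow_copy c F G \<longleftrightarrow> (\<exists>\<phi>. embedding \<phi> G F \<and> inj_on (\<lambda>e. c (\<phi> ` e)) (edges G))"

text \<open>Both numbers are minima taken in \<^typ>\<open>enat\<close>, so that the value is \<open>\<infinity>\<close> if no
  suitable \<open>n\<close> exists. Colorings are functions on all sets of naturals of which only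
  the values on the edges of \<open>K3 n\<close> matter; since \<open>K3 n\<close> is finite, colors in
  \<^typ>\<open>nat\<close> allow any number of colors.\<close>

definition R2 :: "'a hypergraph \<Rightarrow> enat" where
  "R2 H = Inf (enat ` {n. \<forall>c :: nat set \<Rightarrow> nat.
     c ` edges (K3 n) \<subseteq> {0, 1} \<longrightarrow> has_mono_copy c (K3 n) H})"

definition constrained_ramsey :: "'a hypergraph \<Rightarrow> 'b hypergraph \<Rightarrow> enat" where
  "constrained_ramsey H G = Inf (enat ` {n. \<forall>c :: nat set \<Rightarrow> nat.
     has_mono_copy c (K3 n) H \<or> has_rainbow_copy c (K3 n) G})"

definition loose_path :: "nat hypergraph" where
  "loose_path = ({1..7}, {{1, 2, 3}, {3, 4, 5}, {5, 6, 7}})"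

end

theory Submission
  imports Defs
begin

text \<open>
  Two-colorings contain no rainbow loose path, so only the upper bound needs an argument. Call two
  triples close if they share two vertices, and far otherwise. In a coloring of the triples of at
  least 7 vertices without a rainbow loose path, no three pairwise far triples have three different
  colors. If there are at least three colors, it follows that there are colors \<open>\<alpha> \<noteq> \<beta>\<close> such that
  every triple of color \<open>\<alpha>\<close> is close to every triple whose color is neither \<open>\<alpha>\<close> nor \<open>\<beta>\<close>.
  The triples not colored \<open>\<beta>\<close> then form such a small family that some permutation of the vertices
  moves all of them into color \<open>\<beta>\<close>. Now distinguish only \<open>\<beta>\<close> from the other colors: a copy of
  \<open>H\<close> in the resulting two-coloring either has color \<open>\<beta>\<close> or is moved into it by the permutation.
\<close>

section \<open>Naming the vertices of a triple\<close>

lemma nsets_3_obtain1: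
  assumes "X \<in> nsets V 3" "v \<in> X"
  obtains a b where "X = {v, a, b}" "distinct [v, a, b]"
proof -
  have "card (X - {v}) = 2"
    using assms by (simp add: nsets_def)
  then obtain a b where "X - {v} = {a, b}" "a \<noteq> b"
    by (auto simp: card_2_iff)
  with assms(2) have "X = {v, a, b}" "distinct [v, a, b]"
    by auto
  then show thesis
    by (rule that)
qed

lemma nsets_3_obtain2:
  assumes "X \<in> nsets V 3" "u \<in> X" "v \<in> X" "u \<noteq> v"
  obtains w where "X = {u, v, w}" "distinct [u, v, w]"
proof -
  have "card (X - {u, v}) = 1"
    using assms by (simp add: nsets_def card_Diff_subset)
  then obtain w where "X - {u, v} = {w}"
    by (auto simp: card_1_singleton_iff)
  with assms have "X = {u, v, w}" "distinct [u, v, w]"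
    by auto
  then show thesis
    by (rule that)
qed

lemma notin_if_card_Int_le_1:
  assumes "card (X \<inter> Y) \<le> 1" "X \<in> nsets V 3" "v \<in> X" "v \<in> Y" "w \<in> X" "w \<noteq> v"
  shows "w \<notin> Y"
proof
  assume "w \<in> Y"
  then have "card {v, w} \<le> card (X \<inter> Y)"
    using assms by (intro card_mono) (auto simp: nsets_def)
  then show False
    using assms by simp
qed

section \<open>Rainbow configurations of three triples that pairwise share at most one
  vertex\<close>

text \<open>Absence of a rainbow loose path is phrased on seven named vertices so that it acts as a
  forcing rule: when two triples of a loose path have known different colors, the third has one of
  these two. Two such paths often pin a color, three can leave none.\<close>

locale rainbow_path_free =
  fixes V :: "'v set" and c :: "'v set \<Rightarrow> 'c"
  assumes finite_V: "finite V" and card_V: "7 \<le> card V"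
    and path: "\<lbrakk>distinct [u, v, w, x, y, z, t]; {u, v, w, x, y, z, t} \<subseteq> V\<rbrakk> \<Longrightarrow>
      c {u, v, w} = c {w, x, y} \<or> c {w, x, y} = c {y, z, t} \<or> c {u, v, w} = c {y, z, t}"
begin

text \<open>The transversal \<open>{a3, b1, d1}\<close> links every two of the three triples to a
  loose path, so its color would have to lie in each of the three pairs of colors.\<close>

lemma matching_not_rainbow:
  assumes "distinct [a1, a2, a3, b1, b2, b3, d1, d2, d3]"
    "{a1, a2, a3, b1, b2, b3, d1, d2, d3} \<subseteq> V"
    and "c {a1, a2, a3} = \<alpha>" "c {b1, b2, b3} = \<beta>" "c {d1, d2, d3} = \<gamma>"
      "\<alpha> \<noteq> \<beta>" "\<alpha> \<noteq> \<gamma>" "\<beta> \<noteq> \<gamma>"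
  shows False
  using assms path[of a1 a2 a3 d1 b1 b2 b3] path[of a1 a2 a3 b1 d1 d2 d3] path[of b2 b3 b1 a3 d1 d2 d3]
  by (auto simp: insert_commute)

text \<open>Two transversals through \<open>x\<close> are forced into color \<gamma>, since each
  links \<open>{x, y, z}\<close> to both of the meeting triples.\<close>

lemma path_plus_edge_not_rainbow:
  assumes "distinct [v1, v2, v3, v4, v5, x, y, z]" "{v1, v2, v3, v4, v5, x, y, z} \<subseteq> V"
    and "c {v1, v2, v3} = \<alpha>" "c {v3, v4, v5} = \<beta>" "c {x, y, z} = \<gamma>"
      "\<alpha> \<noteq> \<beta>" "\<alpha> \<noteq> \<gamma>" "\<beta> \<noteq> \<gamma>"
  shows False
proof -
  have "c {v1, v4, x} = \<gamma>"
    using assms path[of v2 v3 v1 v4 x y z] path[of v5 v3 v4 v1 x y z] by (auto simp: insert_commute)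
  moreover have "c {v2, v5, x} = \<gamma>"
    using assms path[of v1 v3 v2 v5 x y z] path[of v4 v3 v5 v2 x y z] by (auto simp: insert_commute)
  \<comment> \<open>The triple \<open>{v2, y, z}\<close> is an end of three loose paths whose other
    two triples carry the colors \<alpha> and \<beta>, \<beta> and \<gamma>, \<alpha> and \<gamma>.
    The intersection is empty.\<close>
  ultimately have "c {v2, y, z} \<in> {\<alpha>, \<beta>} \<inter> {\<beta>, \<gamma>} \<inter> {\<alpha>, \<gamma>}"
    using assms path[of v4 v5 v3 v1 v2 y z] path[of y z v2 x v5 v3 v4] path[of x v4 v1 v3 v2 y z]
    by (simp add: insert_commute) metis
  then show False
    using assms by auto
qed

text \<open>The triples form a loose triangle with corners \<open>v1\<close>, \<open>v3\<close>,
  \<open>v5\<close>, and \<open>v7\<close> is a spare vertex. First, \<open>v7\<close> with two of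
  the middle vertices \<open>v2\<close>, \<open>v4\<close>, \<open>v6\<close> must take the color of
  the side that contains neither of them; further triples are then pinned by two paths each.\<close>

lemma triangle_not_rainbow:
  assumes "distinct [v1, v2, v3, v4, v5, v6, v7]" "{v1, v2, v3, v4, v5, v6, v7} \<subseteq> V"
    and "c {v1, v2, v3} = \<alpha>" "c {v3, v4, v5} = \<beta>" "c {v5, v6, v1} = \<gamma>"
      "\<alpha> \<noteq> \<beta>" "\<alpha> \<noteq> \<gamma>" "\<beta> \<noteq> \<gamma>"
  shows False
proof -
  have 267: "c {v2, v6, v7} = \<beta>"
    using assms path[of v4 v5 v3 v1 v2 v6 v7] path[of v2 v7 v6 v1 v5 v4 v3]
    by (auto simp: insert_commute)
  have 467: "c {v4, v6, v7} = \<alpha>"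
    using assms path[of v6 v7 v4 v5 v3 v2 v1] path[of v4 v7 v6 v5 v1 v2 v3]
    by (auto simp: insert_commute)
  have 247: "c {v2, v4, v7} = \<gamma>"
    using assms path[of v4 v7 v2 v3 v1 v6 v5] path[of v2 v7 v4 v3 v5 v6 v1]
    by (auto simp: insert_commute)
  have 457: "c {v4, v5, v7} = \<alpha>"
    using assms 267 path[of v4 v5 v7 v6 v2 v1 v3] path[of v4 v7 v5 v6 v1 v2 v3]
    by (auto simp: insert_commute)
  have 127: "c {v1, v2, v7} = \<beta>"
    using assms 467 path[of v1 v2 v7 v6 v4 v3 v5] path[of v2 v7 v1 v6 v5 v4 v3]
    by (auto simp: insert_commute)
  have 237: "c {v2, v3, v7} = \<gamma>"
    using assms 467 path[of v2 v3 v7 v4 v6 v1 v5] path[of v2 v7 v3 v4 v5 v6 v1]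
    by (auto simp: insert_commute)
  have 567: "c {v5, v6, v7} = \<alpha>"
    using assms 247 path[of v5 v6 v7 v4 v2 v1 v3] path[of v6 v7 v5 v4 v3 v2 v1]
    by (auto simp: insert_commute)
  have 167: "c {v1, v6, v7} = \<beta>"
    using assms 247 path[of v1 v6 v7 v2 v4 v3 v5] path[of v6 v7 v1 v2 v3 v4 v5]
    by (auto simp: insert_commute)
  have 136: "c {v1, v3, v6} = \<alpha>"
    using assms 127 457 237 path[of v3 v6 v1 v2 v7 v4 v5] path[of v1 v6 v3 v2 v7 v4 v5]
    by (auto simp: insert_commute)
  have 145: "c {v1, v4, v5} = \<gamma>"
    using assms 237 567 167 path[of v1 v4 v5 v6 v7 v2 v3] path[of v4 v5 v1 v6 v7 v2 v3]
    by (auto simp: insert_commute)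
  \<comment> \<open>The closing path has the triples \<open>{v2, v7, v6}\<close>,
    \<open>{v6, v3, v1}\<close>, \<open>{v1, v4, v5}\<close> in the colors \<beta>, \<alpha>,
    \<gamma>.\<close>
  show False
    using assms 267 136 145 path[of v2 v7 v6 v3 v1 v4 v5]
    by (auto simp: insert_commute)
qed

text \<open>A single path leaves only \<alpha> or \<beta>. Assuming \<beta>, replacing the center
  \<open>v0\<close> of a petal by any vertex of another petal turns out to shift the color
  cyclically: the pair \<open>v1\<close>, \<open>v2\<close> always gets \<gamma>, the pair
  \<open>v3\<close>, \<open>v4\<close> gets \<alpha>, the pair \<open>v5\<close>, \<open>v6\<close>
  gets \<beta>.\<close>

lemma sunflower_cross_color:
  assumes "distinct [v0, v1, v2, v3, v4, v5, v6]" "{v0, v1, v2, v3, v4, v5, v6} \<subseteq> V"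
    and "c {v0, v1, v2} = \<alpha>" "c {v0, v3, v4} = \<beta>" "c {v0, v5, v6} = \<gamma>"
      "\<alpha> \<noteq> \<beta>" "\<alpha> \<noteq> \<gamma>" "\<beta> \<noteq> \<gamma>"
  shows "c {v1, v5, v6} = \<alpha>"
proof (rule ccontr)
  assume "c {v1, v5, v6} \<noteq> \<alpha>"
  then have 156: "c {v1, v5, v6} = \<beta>"
    using assms path[of v5 v6 v1 v2 v0 v3 v4] by (auto simp: insert_commute)
  have 534: "c {v5, v3, v4} = \<alpha>"
    using assms 156 path[of v3 v4 v5 v6 v1 v2 v0] path[of v3 v4 v5 v6 v0 v1 v2]
    by (auto simp: insert_commute)
  have 634: "c {v6, v3, v4} = \<alpha>"
    using assms 156 path[of v3 v4 v6 v5 v1 v2 v0] path[of v3 v4 v6 v5 v0 v1 v2]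
    by (auto simp: insert_commute)
  have 234: "c {v2, v3, v4} = \<alpha>"
    using assms 156 path[of v3 v4 v2 v0 v1 v5 v6] path[of v3 v4 v2 v1 v0 v5 v6]
    by (auto simp: insert_commute)
  have 512: "c {v5, v1, v2} = \<gamma>"
    using assms 634 path[of v1 v2 v5 v0 v6 v3 v4] path[of v1 v2 v5 v6 v0 v3 v4]
    by (auto simp: insert_commute)
  have 612: "c {v6, v1, v2} = \<gamma>"
    using assms 534 path[of v1 v2 v6 v0 v5 v3 v4] path[of v1 v2 v6 v5 v0 v3 v4]
    by (auto simp: insert_commute)
  have 312: "c {v3, v1, v2} = \<gamma>"
    using assms 634 path[of v1 v2 v3 v4 v6 v5 v0] path[of v1 v2 v3 v4 v0 v5 v6]
    by (auto simp: insert_commute)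
  have 412: "c {v4, v1, v2} = \<gamma>"
    using assms 634 path[of v1 v2 v4 v3 v6 v5 v0] path[of v1 v2 v4 v3 v0 v5 v6]
    by (auto simp: insert_commute)
  have 256: "c {v2, v5, v6} = \<beta>"
    using assms 312 path[of v5 v6 v2 v1 v3 v4 v0] path[of v5 v6 v2 v1 v0 v3 v4]
    by (auto simp: insert_commute)
  have 134: "c {v1, v3, v4} = \<alpha>"
    using assms 256 path[of v3 v4 v1 v0 v2 v5 v6] path[of v3 v4 v1 v2 v0 v5 v6]
    by (auto simp: insert_commute)
  have 356: "c {v3, v5, v6} = \<beta>"
    using assms 412 path[of v5 v6 v3 v0 v4 v1 v2] path[of v5 v6 v3 v4 v0 v1 v2]
    by (auto simp: insert_commute)
  have 456: "c {v4, v5, v6} = \<beta>"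
    using assms 312 path[of v5 v6 v4 v0 v3 v1 v2] path[of v5 v6 v4 v3 v0 v1 v2]
    by (auto simp: insert_commute)
  \<comment> \<open>The remaining triples contain the center and one vertex from each of two petals;
    the closing paths pass through them.\<close>
  have 014: "c {v0, v1, v4} = \<beta>"
    using assms 312 356 256 234 path[of v0 v4 v1 v2 v3 v5 v6] path[of v0 v1 v4 v3 v2 v5 v6]
    by (auto simp: insert_commute)
  have 023: "c {v0, v2, v3} = \<beta>"
    using assms 412 456 156 134 path[of v0 v3 v2 v1 v4 v5 v6] path[of v0 v2 v3 v4 v1 v5 v6]
    by (auto simp: insert_commute)
  have 026: "c {v0, v2, v6} = \<alpha>"
    using assms 512 534 156 134 path[of v0 v2 v6 v5 v1 v3 v4] path[of v0 v6 v2 v1 v5 v3 v4]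
    by (auto simp: insert_commute)
  have 025: "c {v0, v2, v5} = \<alpha>"
    using assms 612 634 156 134 path[of v0 v2 v5 v6 v1 v3 v4] path[of v0 v5 v2 v1 v6 v3 v4]
    by (auto simp: insert_commute)
  have 046: "c {v0, v4, v6} = \<gamma>"
    using assms 312 356 512 534 path[of v0 v4 v6 v5 v3 v1 v2] path[of v0 v6 v4 v3 v5 v1 v2]
    by (auto simp: insert_commute)
  \<comment> \<open>The three paths confine the color of \<open>{v1, v3, v5}\<close> to \<alpha> or
    \<beta>, to \<alpha> or \<gamma>, and to \<beta> or \<gamma>.\<close>
  show False
    using assms 014 023 026 025 046
      path[of v3 v5 v1 v4 v0 v2 v6] path[of v1 v3 v5 v2 v0 v4 v6] path[of v1 v5 v3 v2 v0 v4 v6]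
    by (auto simp: insert_commute)
qed

text \<open>The petals may be permuted in \<open>sunflower_cross_color\<close>. Three of the
  resulting colors already leave none for \<open>{v2, v4, v5}\<close>, the middle of three loose
  paths.\<close>

lemma sunflower_not_rainbow:
  assumes "distinct [v0, v1, v2, v3, v4, v5, v6]" "{v0, v1, v2, v3, v4, v5, v6} \<subseteq> V"
    and "c {v0, v1, v2} = \<alpha>" "c {v0, v3, v4} = \<beta>" "c {v0, v5, v6} = \<gamma>"
      "\<alpha> \<noteq> \<beta>" "\<alpha> \<noteq> \<gamma>" "\<beta> \<noteq> \<gamma>"
  shows False
proof -
  have "c {v1, v5, v6} = \<alpha>" "c {v1, v3, v4} = \<alpha>" "c {v3, v1, v2} = \<beta>"
    using assms sunflower_cross_color[of v0 v1 v2 v3 v4 v5 v6 \<alpha> \<beta> \<gamma>]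
      sunflower_cross_color[of v0 v1 v2 v5 v6 v3 v4 \<alpha> \<gamma> \<beta>]
      sunflower_cross_color[of v0 v3 v4 v5 v6 v1 v2 \<beta> \<gamma> \<alpha>]
    by auto
  then have "c {v2, v4, v5} \<in> {\<alpha>, \<beta>} \<inter> {\<alpha>, \<gamma>} \<inter> {\<beta>, \<gamma>}"
    using assms path[of v1 v6 v5 v2 v4 v3 v0] path[of v1 v3 v4 v2 v5 v6 v0]
      path[of v1 v3 v2 v4 v5 v6 v0]
    by (simp add: insert_commute) metis
  then show False
    using assms by auto
qed

text \<open>The three triples themselves form a loose path with \<open>Y\<close> in the
  middle.\<close>

lemma meeting_edges_not_rainbow:
  assumes X: "X \<in> nsets V 3" and Y: "Y \<in> nsets V 3" and E: "E \<in> nsets V 3"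
    and XY: "card (X \<inter> Y) \<le> 1" and YE: "card (Y \<inter> E) \<le> 1" and XE: "X \<inter> E = {}"
    and v: "v \<in> X" "v \<in> Y" and y: "y \<in> Y" "y \<in> E"
    and ne: "c X \<noteq> c Y" "c X \<noteq> c E" "c Y \<noteq> c E"
  shows False
proof -
  have "v \<noteq> y"
    using v y XE by blast
  obtain a a' where a: "X = {v, a, a'}" "distinct [v, a, a']"
    using X v(1) by (rule nsets_3_obtain1)
  obtain b where b: "Y = {v, y, b}" "distinct [v, y, b]"
    using Y v(2) y(1) \<open>v \<noteq> y\<close> by (rule nsets_3_obtain2)
  obtain e e' where e: "E = {y, e, e'}" "distinct [y, e, e']"
    using E y(2) by (rule nsets_3_obtain1)
  have "a \<notin> Y" "a' \<notin> Y"
    using a notin_if_card_Int_le_1[OF XY X v] by auto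
  moreover have "b \<notin> E"
    using b notin_if_card_Int_le_1[OF YE Y y] by auto
  ultimately have d: "distinct [a, a', v, b, y, e, e']"
    using a(2) b(2) e(2) XE unfolding a(1) b(1) e(1) by auto
  have "{a, a', v, b, y, e, e'} \<subseteq> V"
    using X Y E unfolding a(1) b(1) e(1) by (simp add: nsets_def)
  moreover have "X = {a, a', v}" "Y = {v, b, y}"
    unfolding a(1) b(1) by auto
  ultimately show False
    using path[OF d] ne e(1) by metis
qed

text \<open>The position of \<open>E\<close> decides the configuration: a sunflower, a path with a
  disjoint triple, a loose path with middle \<open>B\<close> or \<open>A\<close>, or a loose
  triangle.\<close>

lemma intersecting_linear_triple_not_rainbow:
  assumes A: "A \<in> nsets V 3" and B: "B \<in> nsets V 3" and E: "E \<in> nsets V 3"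
    and AB: "card (A \<inter> B) \<le> 1" and AE: "card (A \<inter> E) \<le> 1" and BE: "card (B \<inter> E) \<le> 1"
    and ne: "c A \<noteq> c B" "c A \<noteq> c E" "c B \<noteq> c E" and v: "v \<in> A" "v \<in> B"
  shows False
proof -
  obtain a a' where a: "A = {v, a, a'}" "distinct [v, a, a']"
    using A v(1) by (rule nsets_3_obtain1)
  obtain b b' where b: "B = {v, b, b'}" "distinct [v, b, b']"
    using B v(2) by (rule nsets_3_obtain1)
  have ab: "a \<notin> B" "a' \<notin> B"
    using a notin_if_card_Int_le_1[OF AB A v] by auto
  consider "v \<in> E" | "A \<inter> E = {}" "B \<inter> E = {}" | y where "A \<inter> E = {}" "y \<in> B" "y \<in> E"
    | x where "B \<inter> E = {}" "x \<in> A" "x \<in> E"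
    | x y where "v \<notin> E" "x \<in> A" "x \<in> E" "y \<in> B" "y \<in> E"
    by blast
  then show False
  proof cases
    case 1
    obtain e e' where e: "E = {v, e, e'}" "distinct [v, e, e']"
      using E 1 by (rule nsets_3_obtain1)
    have "a \<notin> E" "a' \<notin> E" "b \<notin> E" "b' \<notin> E"
      using a b notin_if_card_Int_le_1[OF AE A v(1) 1] notin_if_card_Int_le_1[OF BE B v(2) 1] by auto
    with ab have d: "distinct [v, a, a', b, b', e, e']"
      using a(2) b(2) e(2) unfolding a(1) b(1) e(1) by auto
    have "{v, a, a', b, b', e, e'} \<subseteq> V"
      using A B E unfolding a(1) b(1) e(1) by (simp add: nsets_def)
    then show False
      using sunflower_not_rainbow[OF d _ refl refl refl] ne unfolding a(1) b(1) e(1) by blast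
  next
    case 2
    obtain x y z where e: "E = {x, y, z}" "distinct [x, y, z]"
      using E by (auto simp: nsets_def card_3_iff)
    have d: "distinct [a, a', v, b, b', x, y, z]"
      using a(2) b(2) e(2) ab 2 unfolding a(1) b(1) e(1) by auto
    have "{a, a', v, b, b', x, y, z} \<subseteq> V"
      using A B E unfolding a(1) b(1) e(1) by (simp add: nsets_def)
    moreover have "A = {a, a', v}"
      unfolding a(1) by auto
    ultimately show False
      using path_plus_edge_not_rainbow[OF d _ refl refl refl] ne unfolding b(1) e(1) by simp
  next
    case 3
    then show False
      using meeting_edges_not_rainbow[OF A B E AB BE _ v _ _ ne] by blast
  next
    case 4
    then show False
      using meeting_edges_not_rainbow[OF B A E _ AE _ v(2,1)] AB ne by (metis Int_commute)
  next
    case 5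
    have "x \<noteq> v" "v \<noteq> y"
      using 5 by auto
    then have "y \<noteq> x"
      using 5 notin_if_card_Int_le_1[OF AB A v] by auto
    obtain p where p: "A = {x, v, p}" "distinct [x, v, p]"
      using A 5(2) v(1) \<open>x \<noteq> v\<close> by (rule nsets_3_obtain2)
    obtain q where q: "B = {v, y, q}" "distinct [v, y, q]"
      using B v(2) 5(4) \<open>v \<noteq> y\<close> by (rule nsets_3_obtain2)
    obtain z where z: "E = {y, x, z}" "distinct [y, x, z]"
      using E 5(5,3) \<open>y \<noteq> x\<close> by (rule nsets_3_obtain2)
    \<comment> \<open>The triangle covers at most six vertices, so \<open>V\<close> has a spare
      vertex \<open>t\<close> for \<open>triangle_not_rainbow\<close>.\<close>
    have "card {x, p, v, q, y, z} \<le> 6"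
      by (simp add: card_insert_if)
    then have "\<not> V \<subseteq> {x, p, v, q, y, z}"
      using card_V card_mono[of "{x, p, v, q, y, z}" V] by auto
    then obtain t where t: "t \<in> V" "t \<notin> {x, p, v, q, y, z}"
      by blast
    have "x \<notin> B" "p \<notin> B"
      using p notin_if_card_Int_le_1[OF AB A v] by auto
    moreover have "p \<notin> E" "q \<notin> E"
      using p q notin_if_card_Int_le_1[OF AE A 5(2,3)] notin_if_card_Int_le_1[OF BE B 5(4,5)]
      by auto
    ultimately have d: "distinct [x, p, v, q, y, z, t]"
      using p(2) q(2) z(2) t(2) 5(1) unfolding q(1) z(1) by auto
    have "{x, p, v, q, y, z, t} \<subseteq> V"
      using A B E t(1) unfolding p(1) q(1) z(1) by (simp add: nsets_def)
    moreover have "A = {x, p, v}" "B = {v, q, y}" "E = {y, z, x}"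
      unfolding p(1) q(1) z(1) by auto
    ultimately show False
      using triangle_not_rainbow[OF d _ refl refl refl] ne by simp
  qed
qed

text \<open>Three disjoint triples are a matching; otherwise two triples that meet are put in the
  roles of \<open>A\<close> and \<open>B\<close> of the previous lemma.\<close>

lemma linear_triple_not_rainbow:
  assumes A: "A \<in> nsets V 3" and B: "B \<in> nsets V 3" and E: "E \<in> nsets V 3"
    and AB: "card (A \<inter> B) \<le> 1" and AE: "card (A \<inter> E) \<le> 1" and BE: "card (B \<inter> E) \<le> 1"
    and ne: "c A \<noteq> c B" "c A \<noteq> c E" "c B \<noteq> c E"
  shows False
proof (cases "A \<inter> B = {} \<and> A \<inter> E = {} \<and> B \<inter> E = {}")
  case True
  obtain a1 a2 a3 where a: "A = {a1, a2, a3}" "distinct [a1, a2, a3]"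
    using A by (auto simp: nsets_def card_3_iff)
  obtain b1 b2 b3 where b: "B = {b1, b2, b3}" "distinct [b1, b2, b3]"
    using B by (auto simp: nsets_def card_3_iff)
  obtain e1 e2 e3 where e: "E = {e1, e2, e3}" "distinct [e1, e2, e3]"
    using E by (auto simp: nsets_def card_3_iff)
  have d: "distinct [a1, a2, a3, b1, b2, b3, e1, e2, e3]"
    using a(2) b(2) e(2) True unfolding a(1) b(1) e(1) by auto
  have "{a1, a2, a3, b1, b2, b3, e1, e2, e3} \<subseteq> V"
    using A B E unfolding a(1) b(1) e(1) by (simp add: nsets_def)
  then show False
    using matching_not_rainbow[OF d _ refl refl refl] ne unfolding a(1) b(1) e(1) by blast
next
  case False
  then consider v where "v \<in> A" "v \<in> B" | v where "v \<in> A" "v \<in> E" | v where "v \<in> B" "v \<in> E"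
    by blast
  then show False
  proof cases
    case 1
    then show False
      using intersecting_linear_triple_not_rainbow[OF A B E AB AE BE ne] by blast
  next
    case 2
    then show False
      using intersecting_linear_triple_not_rainbow[OF A E B AE AB] BE ne by (metis Int_commute)
  next
    case 3
    then show False
      using intersecting_linear_triple_not_rainbow[OF B E A BE] AB AE ne by (metis Int_commute)
  qed
qed

section \<open>Close and far triples, and the two special colors\<close>

text \<open>This configuration supplies the two special colors: \<alpha> will be \<open>c A\<close>
  and \<beta> will be \<open>c B\<close>, while \<open>E\<close> witnesses a color different from
  both.\<close>

definition far_triple :: "'v set \<Rightarrow> 'v set \<Rightarrow> 'v set \<Rightarrow> bool" where
  "far_triple A E B \<longleftrightarrow> A \<in> nsets V 3 \<and> E \<in> nsets V 3 \<and> B \<in> nsets V 3 \<and>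
     2 \<le> card (A \<inter> E) \<and> card (A \<inter> B) \<le> 1 \<and> card (E \<inter> B) \<le> 1 \<and>
     c A \<noteq> c E \<and> c A \<noteq> c B \<and> c E \<noteq> c B"

text \<open>At most one of the three triples shares its color with \<open>W\<close>. The other two
  cannot be far from each other, as together with \<open>W\<close> they would contradict
  \<open>linear_triple_not_rainbow\<close>.\<close>

lemma far_triple_if_far_from_all:
  assumes "X \<in> nsets V 3" "Y \<in> nsets V 3" "Z \<in> nsets V 3" "W \<in> nsets V 3"
    and "c X \<noteq> c Y" "c X \<noteq> c Z" "c Y \<noteq> c Z"
    and "card (X \<inter> W) \<le> 1" "card (Y \<inter> W) \<le> 1" "card (Z \<inter> W) \<le> 1"
  shows "\<exists>A E B. far_triple A E B"
proof -
  have *: "\<exists>A E B. far_triple A E B"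
    if "P \<in> nsets V 3" "Q \<in> nsets V 3" "c P \<noteq> c Q" "c P \<noteq> c W" "c Q \<noteq> c W"
      "card (P \<inter> W) \<le> 1" "card (Q \<inter> W) \<le> 1" for P Q
  proof -
    have "\<not> card (P \<inter> Q) \<le> 1"
      using linear_triple_not_rainbow[of P Q W] that assms(4) by blast
    then have "far_triple P Q W"
      using that assms(4) by (simp add: far_triple_def)
    then show ?thesis by blast
  qed
  consider "c X \<noteq> c W" "c Y \<noteq> c W" | "c X \<noteq> c W" "c Z \<noteq> c W" | "c Y \<noteq> c W" "c Z \<noteq> c W"
    using assms by metis
  then show ?thesis
    using *[of X Y] *[of X Z] *[of Y Z] assms by cases auto
qed

text \<open>Two close pairs confine the union to five vertices. Two vertices outside it and one of
  \<open>X\<close> make a triple far from all three.\<close>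

lemma far_triple_if_two_close:
  assumes X: "X \<in> nsets V 3" and Y: "Y \<in> nsets V 3" and Z: "Z \<in> nsets V 3"
    and ne: "c X \<noteq> c Y" "c X \<noteq> c Z" "c Y \<noteq> c Z"
    and close: "2 \<le> card (X \<inter> Y)" "2 \<le> card (Y \<inter> Z)"
  shows "\<exists>A E B. far_triple A E B"
proof -
  let ?U = "X \<union> Y \<union> Z"
  have fin: "finite X" "finite Y" "finite Z" and card: "card X = 3" "card Y = 3" "card Z = 3"
    and sub: "X \<subseteq> V" "Y \<subseteq> V" "Z \<subseteq> V"
    using X Y Z by (auto simp: nsets_def)
  have "card (Y \<inter> Z) \<le> card ((X \<union> Y) \<inter> Z)"
    using fin by (intro card_mono) auto
  then have "card ?U \<le> 5"
    using card_Un_Int[of X Y] card_Un_Int[of "X \<union> Y" Z] fin card close by simp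
  moreover have "card (V - ?U) = card V - card ?U"
    using fin sub by (intro card_Diff_subset) auto
  ultimately have "2 \<le> card (V - ?U)"
    using card_V by simp
  then obtain P where "P \<subseteq> V - ?U" "card P = 2"
    by (rule obtain_subset_with_card_n)
  then obtain p q where pq: "{p, q} \<subseteq> V - ?U" "p \<noteq> q"
    by (auto simp: card_2_iff)
  obtain w where w: "w \<in> X"
    using card(1) by fastforce
  have "w \<noteq> p" "w \<noteq> q"
    using pq w by auto
  then have W: "{w, p, q} \<in> nsets V 3"
    using pq w sub by (auto simp: nsets_def)
  have far: "card (T \<inter> {w, p, q}) \<le> 1" if "T \<subseteq> ?U" for T
    using card_mono[of "{w}" "T \<inter> {w, p, q}"] that pq by auto
  show ?thesis
    by (rule far_triple_if_far_from_all[OF X Y Z W ne]) (rule far, blast)+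
qed

text \<open>Among the three pairs, two are close or two are far. In the second situation the
  remaining pair must be close, and the three triples are already as required.\<close>

lemma ex_far_triple:
  assumes X: "X \<in> nsets V 3" and Y: "Y \<in> nsets V 3" and Z: "Z \<in> nsets V 3"
    and ne: "c X \<noteq> c Y" "c X \<noteq> c Z" "c Y \<noteq> c Z"
  shows "\<exists>A E B. far_triple A E B"
proof -
  consider "2 \<le> card (X \<inter> Y)" "2 \<le> card (Y \<inter> Z)" | "2 \<le> card (X \<inter> Y)" "2 \<le> card (X \<inter> Z)"
    | "2 \<le> card (X \<inter> Z)" "2 \<le> card (Y \<inter> Z)"
    | "card (X \<inter> Y) \<le> 1" "card (X \<inter> Z) \<le> 1" | "card (X \<inter> Y) \<le> 1" "card (Y \<inter> Z) \<le> 1"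
    | "card (X \<inter> Z) \<le> 1" "card (Y \<inter> Z) \<le> 1"
    by linarith
  then show ?thesis
  proof cases
    case 1
    then show ?thesis
      using far_triple_if_two_close[OF X Y Z] ne by blast
  next
    case 2
    then show ?thesis
      using far_triple_if_two_close[OF Y X Z] ne by (metis Int_commute)
  next
    case 3
    then show ?thesis
      using far_triple_if_two_close[OF X Z Y] ne by (metis Int_commute)
  next
    case 4
    then have "\<not> card (Y \<inter> Z) \<le> 1"
      using linear_triple_not_rainbow[OF X Y Z] ne by blast
    then have "far_triple Y Z X"
      using 4 assms by (auto simp: far_triple_def Int_commute)
    then show ?thesis by blast
  next
    case 5
    then have "\<not> card (X \<inter> Z) \<le> 1"
      using linear_triple_not_rainbow[OF X Y Z] ne by blast
    then have "far_triple X Z Y"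
      using 5 assms by (auto simp: far_triple_def Int_commute)
    then show ?thesis by blast
  next
    case 6
    then have "\<not> card (X \<inter> Y) \<le> 1"
      using linear_triple_not_rainbow[OF X Y Z] ne by blast
    then have "far_triple X Y Z"
      using 6 assms by (auto simp: far_triple_def Int_commute)
    then show ?thesis by blast
  qed
qed

text \<open>Both \<open>A\<close>, \<open>B\<close>, \<open>G\<close> and \<open>E\<close>,
  \<open>B\<close>, \<open>G\<close> are pairwise far, so \<open>c G\<close> belongs to
  \<open>{c A, c B}\<close> and to \<open>{c E, c B}\<close>, which have only \<open>c B\<close> in
  common.\<close>

lemma far_triple_extend:
  assumes "far_triple A E B" "G \<in> nsets V 3"
    and "card (A \<inter> G) \<le> 1" "card (E \<inter> G) \<le> 1" "card (B \<inter> G) \<le> 1"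
  shows "far_triple A E G" "c G = c B"
proof -
  have "\<not> (c G \<noteq> c A \<and> c G \<noteq> c B)" "\<not> (c G \<noteq> c E \<and> c G \<noteq> c B)"
    using assms linear_triple_not_rainbow[of A B G] linear_triple_not_rainbow[of E B G]
    unfolding far_triple_def by metis+
  then show "c G = c B"
    using assms unfolding far_triple_def by metis
  then show "far_triple A E G"
    using assms unfolding far_triple_def by simp
qed

lemma far_triple_Diff:
  assumes "far_triple A E B"
  obtains x y where "A - E = {x}" "E - A = {y}" "3 \<le> card (V - (A \<union> E))"
proof -
  have fin: "finite A" "finite E" and card: "card A = 3" "card E = 3" and sub: "A \<subseteq> V" "E \<subseteq> V"
    and "A \<noteq> E" and AE: "2 \<le> card (A \<inter> E)"
    using assms by (auto simp: far_triple_def nsets_def)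
  have "A \<inter> E \<noteq> A"
    using \<open>A \<noteq> E\<close> fin card by (metis card_subset_eq inf.absorb_iff1)
  then have "card (A \<inter> E) < 3"
    using psubset_card_mono[of A "A \<inter> E"] fin card by auto
  then have two: "card (A \<inter> E) = 2"
    using AE by simp
  then have "card (A - E) = 1" "card (E - A) = 1"
    using fin card by (simp_all add: card_Diff_subset_Int Int_commute)
  moreover have "card (A \<union> E) = 4"
    using card_Un_Int[of A E] fin card two by simp
  then have "3 \<le> card (V - (A \<union> E))"
    using card_V fin sub by (simp add: card_Diff_subset)
  ultimately show thesis
    using that by (auto simp: card_1_singleton_iff)
qed

text \<open>The color of \<open>B\<close> spreads by \<open>far_triple_extend\<close>: from
  \<open>B\<close> to one triple \<open>{x, y, r}\<close>, from there to all triples outside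
  \<open>A \<union> E\<close>, and from one of these back to every \<open>{x, y, s}\<close>. Triples
  of these last two kinds share at most one vertex.\<close>

lemma far_triple_colors:
  assumes t: "far_triple A E B" and x: "A - E = {x}" and y: "E - A = {y}"
    and O: "3 \<le> card (V - (A \<union> E))"
  shows "\<forall>T \<in> nsets (V - (A \<union> E)) 3. c T = c B"
    and "\<forall>r \<in> V - (A \<union> E). c {x, y, r} = c B"
proof -
  let ?O = "V - (A \<union> E)"
  have B: "B \<in> nsets V 3" "card (A \<inter> B) \<le> 1" "card (E \<inter> B) \<le> 1" and sub: "A \<subseteq> V" "E \<subseteq> V"
    and fin: "finite B"
    using t by (auto simp: far_triple_def nsets_def)
  have T: "T \<in> nsets V 3" "A \<inter> T = {}" "E \<inter> T = {}" if "T \<in> nsets ?O 3" for T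
    using that by (auto simp: nsets_def)
  have xyr: "{x, y, r} \<in> nsets V 3" "A \<inter> {x, y, r} = {x}" "E \<inter> {x, y, r} = {y}" if "r \<in> ?O" for r
  proof -
    have "x \<in> A" "x \<notin> E" "y \<in> E" "y \<notin> A" "r \<in> V" "r \<notin> A" "r \<notin> E"
      using that x y by auto
    then show "{x, y, r} \<in> nsets V 3" "A \<inter> {x, y, r} = {x}" "E \<inter> {x, y, r} = {y}"
      using sub by (auto simp: nsets_def card_insert_if)
  qed
  have Txyr: "card (T \<inter> {x, y, r}) \<le> 1" "card ({x, y, r} \<inter> T) \<le> 1" if "T \<subseteq> ?O" for T r
    using card_mono[of "{r}" "T \<inter> {x, y, r}"] that x y by (auto simp: Int_commute)
  have "\<exists>r \<in> ?O. far_triple A E {x, y, r} \<and> c {x, y, r} = c B"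
  proof (cases "{x, y} \<subseteq> B")
    case True
    \<comment> \<open>Here \<open>B\<close> is itself of the form \<open>{x, y, r}\<close>, and
      being far from \<open>A\<close> and \<open>E\<close> it has \<open>r\<close> outside
      both.\<close>
    have "x \<noteq> y"
      using x y by auto
    then obtain r where r: "B = {x, y, r}" "distinct [x, y, r]"
      using nsets_3_obtain2[OF B(1), of x y] True by auto
    have "x \<in> A" "y \<in> E" using x y by auto
    then have "r \<notin> A" "r \<notin> E"
      using r notin_if_card_Int_le_1[of B A V x r] notin_if_card_Int_le_1[of B E V y r] B
      by (auto simp: Int_commute)
    then show ?thesis
      using t B(1) r(1) by (auto simp: nsets_def)
  next
    case False
    \<comment> \<open>If \<open>?O\<close> lies inside \<open>B\<close>, its size makes it equal to
      \<open>B\<close>, and every \<open>r\<close> in it works. Otherwise any \<open>r\<close>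
      outside \<open>B\<close> works, because \<open>B\<close> misses \<open>x\<close> or
      \<open>y\<close>.\<close>
    have "\<exists>r \<in> ?O. card (B \<inter> {x, y, r}) \<le> 1"
    proof (cases "?O \<subseteq> B")
      case True
      then have "?O = B"
        using O B(1) fin by (intro card_seteq) (auto simp: nsets_def)
      moreover have "?O \<noteq> {}"
        using O by (metis card.empty not_numeral_le_zero)
      then obtain r where "r \<in> ?O"
        by blast
      ultimately show ?thesis
        using Txyr(1) by blast
    next
      case False
      then obtain r where "r \<in> ?O" "r \<notin> B"
        by blast
      moreover from \<open>r \<notin> B\<close> \<open>\<not> {x, y} \<subseteq> B\<close> have "B \<inter> {x, y, r} \<subseteq> {x} \<or> B \<inter> {x, y, r} \<subseteq> {y}"
        by auto
      then have "card (B \<inter> {x, y, r}) \<le> 1"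
        using card_mono[of "{x}" "B \<inter> {x, y, r}"] card_mono[of "{y}" "B \<inter> {x, y, r}"] by auto
      ultimately show ?thesis by blast
    qed
    then show ?thesis
      using far_triple_extend[OF t] xyr by (metis card.empty card_insert_disjoint empty_iff
          finite.emptyI le_refl One_nat_def)
  qed
  then obtain r where r: "r \<in> ?O" "far_triple A E {x, y, r}" "c {x, y, r} = c B"
    by blast
  have T_color: "far_triple A E T \<and> c T = c B" if "T \<in> nsets ?O 3" for T
    using far_triple_extend[OF r(2), of T] T[OF that] Txyr(2)[of T r] that r(3)
    by (auto simp: nsets_def)
  then show "\<forall>T \<in> nsets ?O 3. c T = c B"
    by blast
  obtain T where "T \<subseteq> ?O" "card T = 3" "finite T"
    using O by (rule obtain_subset_with_card_n)
  then have T': "T \<in> nsets ?O 3"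
    by (simp add: nsets_def)
  show "\<forall>r \<in> ?O. c {x, y, r} = c B"
  proof
    fix s assume "s \<in> ?O"
    then show "c {x, y, s} = c B"
      using far_triple_extend(2)[of A E T "{x, y, s}"] T_color[OF T'] xyr[of s] Txyr(1)[of T s] \<open>T \<subseteq> ?O\<close>
      by auto
  qed
qed

text \<open>If \<open>Z\<close> were far from \<open>K\<close>, it would have to be close to every
  triple of color \<open>c B\<close> that is far from \<open>K\<close>. By
  \<open>far_triple_colors\<close> these include some \<open>T\<close> outside
  \<open>A \<union> E\<close> and all \<open>{x, y, r}\<close> with \<open>r\<close> in
  \<open>T\<close>, too many for one triple.\<close>

lemma far_triple_close:
  assumes t: "far_triple A E B" and K: "K \<in> {A, E}" and Z: "Z \<in> nsets V 3"
    and ne: "c Z \<noteq> c K" "c Z \<noteq> c B"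
  shows "2 \<le> card (Z \<inter> K)"
proof (rule ccontr)
  assume far: "\<not> 2 \<le> card (Z \<inter> K)"
  obtain x y where xy: "A - E = {x}" "E - A = {y}" and O: "3 \<le> card (V - (A \<union> E))"
    using t by (rule far_triple_Diff)
  let ?O = "V - (A \<union> E)"
  note col = far_triple_colors[OF t xy O]
  have K': "K \<in> nsets V 3" "c K \<noteq> c B" and sub: "A \<subseteq> V" "E \<subseteq> V" and finZ: "finite Z" "card Z = 3"
    using K t Z by (auto simp: far_triple_def nsets_def)
  have close: "2 \<le> card (Z \<inter> T)" if "T \<in> nsets V 3" "c T = c B" "card (K \<inter> T) \<le> 1" for T
    using linear_triple_not_rainbow[OF Z K'(1) that(1)] that ne K'(2) far by force
  obtain T where T: "T \<subseteq> ?O" "card T = 3" "finite T"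
    using O by (rule obtain_subset_with_card_n)
  have "K \<inter> T = {}"
    using T K by auto
  then have ZT: "2 \<le> card (Z \<inter> T)"
    using T col(1) by (intro close) (auto simp: nsets_def)
  have Zxyr: "2 \<le> card (Z \<inter> {x, y, r})" if "r \<in> T" for r
  proof (rule close)
    have *: "x \<in> A" "x \<notin> E" "y \<in> E" "y \<notin> A" "r \<in> V" "r \<notin> A" "r \<notin> E"
      using that T xy by auto
    then show "{x, y, r} \<in> nsets V 3"
      using sub by (auto simp: nsets_def card_insert_if)
    show "c {x, y, r} = c B"
      using col(2) that T by blast
    have "K \<inter> {x, y, r} \<subseteq> {x} \<or> K \<inter> {x, y, r} \<subseteq> {y}"
      using K * by auto
    then show "card (K \<inter> {x, y, r}) \<le> 1"
      using card_mono[of "{x}" "K \<inter> {x, y, r}"] card_mono[of "{y}" "K \<inter> {x, y, r}"] by auto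
  qed
  have xT: "x \<notin> T" "y \<notin> T"
    using T xy by auto
  show False
  \<comment> \<open>If \<open>Z\<close> is \<open>T\<close>, it meets \<open>{x, y, r}\<close> in
    \<open>r\<close> alone. Otherwise some \<open>r\<close> of \<open>T\<close> is not in
    \<open>Z\<close>, and only the at most one vertex of \<open>Z\<close> outside \<open>T\<close>
    can lie in \<open>{x, y, r}\<close>.\<close>
  proof (cases "T \<subseteq> Z")
    case True
    then have "T = Z"
      using T finZ by (intro card_seteq) auto
    moreover obtain r where "r \<in> T"
      using T by fastforce
    ultimately show False
      using Zxyr[of r] card_mono[of "{r}" "Z \<inter> {x, y, r}"] xT by auto
  next
    case False
    then obtain r where r: "r \<in> T" "r \<notin> Z"
      by blast
    have "card (Z \<inter> {x, y, r}) \<le> card (Z - T)"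
      using finZ xT r by (intro card_mono) auto
    also have "\<dots> \<le> 1"
      using ZT finZ by (simp add: card_Diff_subset_Int)
    finally show False
      using Zxyr[OF r(1)] by simp
  qed
qed

text \<open>With \<alpha> and \<beta> the colors of \<open>A\<close> and \<open>B\<close>,
  \<open>far_triple_close\<close> makes a triple of color \<alpha> close to \<open>E\<close>, and
  one of color neither \<alpha> nor \<beta> close to \<open>A\<close>. Each keeps at most one vertex
  for a triple \<open>T\<close> of color \<beta> outside \<open>A \<union> E\<close>, so if they
  were far from each other, the three would be pairwise far in three colors.\<close>

lemma color_structure:
  assumes "X \<in> nsets V 3" "Y \<in> nsets V 3" "Z \<in> nsets V 3" "c X \<noteq> c Y" "c X \<noteq> c Z" "c Y \<noteq> c Z"
  obtains \<alpha> \<beta> where "\<exists>X \<in> nsets V 3. c X = \<alpha>" "\<exists>Y \<in> nsets V 3. c Y \<notin> {\<alpha>, \<beta>}" "\<alpha> \<noteq> \<beta>"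
    "\<And>X Y. \<lbrakk>X \<in> nsets V 3; Y \<in> nsets V 3; c X = \<alpha>; c Y \<notin> {\<alpha>, \<beta>}\<rbrakk> \<Longrightarrow> 2 \<le> card (X \<inter> Y)"
proof -
  obtain A E B where t: "far_triple A E B"
    using ex_far_triple assms by blast
  obtain x y where xy: "A - E = {x}" "E - A = {y}" and O: "3 \<le> card (V - (A \<union> E))"
    using t by (rule far_triple_Diff)
  obtain T where T: "T \<subseteq> V - (A \<union> E)" "card T = 3" "finite T"
    using O by (rule obtain_subset_with_card_n)
  then have cT: "c T = c B" and T': "T \<in> nsets V 3"
    using far_triple_colors(1)[OF t xy O] by (auto simp: nsets_def)
  have tn: "A \<in> nsets V 3" "E \<in> nsets V 3" "c A \<noteq> c E" "c A \<noteq> c B" "c E \<noteq> c B"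
    using t by (auto simp: far_triple_def)
  have "2 \<le> card (X \<inter> Y)"
    if XY: "X \<in> nsets V 3" "Y \<in> nsets V 3" "c X = c A" "c Y \<notin> {c A, c B}" for X Y
  proof (rule ccontr)
    assume "\<not> 2 \<le> card (X \<inter> Y)"
    have *: "card (W \<inter> T) \<le> 1" if "W \<in> nsets V 3" "2 \<le> card (W \<inter> K)" "K \<in> {A, E}" for W K
    proof -
      have "finite W" "card W = 3"
        using that by (auto simp: nsets_def)
      have "card (W \<inter> T) \<le> card (W - K)"
        using \<open>finite W\<close> T that(3) by (intro card_mono) auto
      also have "\<dots> \<le> 1"
        using that(2) \<open>finite W\<close> \<open>card W = 3\<close> by (simp add: card_Diff_subset_Int)
      finally show ?thesis .
    qed
    have "2 \<le> card (X \<inter> E)" "2 \<le> card (Y \<inter> A)"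
      using XY tn by (auto intro!: far_triple_close[OF t])
    then have "card (X \<inter> T) \<le> 1" "card (Y \<inter> T) \<le> 1"
      using *[of X E] *[of Y A] XY by auto
    then show False
      using linear_triple_not_rainbow[OF XY(1,2) T'] XY(3,4) cT tn \<open>\<not> 2 \<le> card (X \<inter> Y)\<close> by auto
  qed
  moreover have "\<exists>X \<in> nsets V 3. c X = c A"
    using tn(1) by blast
  moreover have "\<exists>Y \<in> nsets V 3. c Y \<notin> {c A, c B}"
    using tn(2,3,5) by (intro bexI[of _ E]) auto
  ultimately show thesis
    using tn(4) by (intro that[of "c A" "c B"])
qed

end

section \<open>Families of triples close to each other, and permutations that displace them\<close>

text \<open>By inclusion and exclusion, \<open>card (f \<inter> (e \<union> g)) + card (f \<inter>
  (e \<inter> g))\<close> is at least 4, while its summands are at most 3 and 1. Equality in both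
  bounds gives all three conclusions.\<close>

lemma close_to_far_pair:
  assumes fin: "finite e" "finite g" "finite f" and "card f = 3"
    and "card (e \<inter> g) \<le> 1" "2 \<le> card (f \<inter> e)" "2 \<le> card (f \<inter> g)"
  shows "e \<inter> g \<subseteq> f" "card (e \<inter> g) = 1" "f \<subseteq> e \<union> g"
proof -
  have eq: "card (f \<inter> e) + card (f \<inter> g) = card (f \<inter> (e \<union> g)) + card (f \<inter> (e \<inter> g))"
    using card_Un_Int[of "f \<inter> e" "f \<inter> g"] fin by (simp add: Int_Un_distrib Int_ac)
  have le: "card (f \<inter> (e \<union> g)) \<le> card f" "card (f \<inter> (e \<inter> g)) \<le> card (e \<inter> g)"
    using fin by (auto intro!: card_mono)
  show "card (e \<inter> g) = 1"
    using eq le assms by linarith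
  have "f \<inter> (e \<union> g) = f"
    by (rule card_subset_eq) (use eq le assms in auto)
  moreover have "f \<inter> (e \<inter> g) = e \<inter> g"
    by (rule card_subset_eq) (use eq le assms in auto)
  ultimately show "e \<inter> g \<subseteq> f" "f \<subseteq> e \<union> g"
    by blast+
qed

text \<open>A member close to its whole family serves as the core. If neither \<open>e\<close> nor
  \<open>f\<close> is such a member, \<open>close_to_far_pair\<close> applies to a far pair in each
  family and fixes a common vertex and an enclosing set for the members of the other one.\<close>

lemma cross_close_families:
  assumes F1: "F1 \<subseteq> nsets V 3" "F1 \<noteq> {}" and F2: "F2 \<subseteq> nsets V 3" "F2 \<noteq> {}"
    and close: "\<And>X Y. \<lbrakk>X \<in> F1; Y \<in> F2\<rbrakk> \<Longrightarrow> 2 \<le> card (X \<inter> Y)"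
  obtains (core) T where "T \<in> nsets V 3" "\<And>X. X \<in> F1 \<union> F2 \<Longrightarrow> 2 \<le> card (X \<inter> T)"
    | (star) a S where "a \<in> V" "finite S" "card S \<le> 6" "\<And>X. X \<in> F1 \<union> F2 \<Longrightarrow> a \<in> X \<and> X \<subseteq> S"
proof -
  have tri: "finite X" "card X = 3" if "X \<in> F1 \<union> F2" for X
    using that F1 F2 by (auto simp: nsets_def)
  obtain e f where ef: "e \<in> F1" "f \<in> F2"
    using F1 F2 by blast
  show thesis
  proof (cases "(\<forall>X\<in>F1. 2 \<le> card (X \<inter> e)) \<or> (\<forall>Y\<in>F2. 2 \<le> card (f \<inter> Y))")
    case True
    then show thesis
    proof
      assume "\<forall>X\<in>F1. 2 \<le> card (X \<inter> e)"
      then show thesis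
        using core[of e] close[OF ef(1)] ef F1 by (auto simp: Int_commute)
    next
      assume "\<forall>Y\<in>F2. 2 \<le> card (f \<inter> Y)"
      then show thesis
        using core[of f] close[OF _ ef(2)] ef F2 by (auto simp: Int_commute)
    qed
  next
    case False
    then obtain g h where g: "g \<in> F1" "card (e \<inter> g) \<le> 1" and h: "h \<in> F2" "card (f \<inter> h) \<le> 1"
      by (force simp: Int_commute not_le)
    have 2: "e \<inter> g \<subseteq> Y" "card (e \<inter> g) = 1" "Y \<subseteq> e \<union> g" if "Y \<in> F2" for Y
      using close_to_far_pair[of e g Y] tri ef g that close[of e Y] close[of g Y]
      by (auto simp: Int_commute)
    have 1: "f \<inter> h \<subseteq> X" "card (f \<inter> h) = 1" "X \<subseteq> f \<union> h" if "X \<in> F1" for X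
      using close_to_far_pair[of f h X] tri ef h that close[of X f] close[of X h]
      by auto
    obtain a where a: "e \<inter> g = {a}"
      using 2(2)[OF ef(2)] by (auto simp: card_1_singleton_iff)
    \<comment> \<open>The two centers agree: both \<open>f\<close> and \<open>h\<close> belong to
      \<open>F2\<close> and so contain \<open>e \<inter> g\<close>, while
      \<open>f \<inter> h\<close> has only one element.\<close>
    then have "a \<in> f \<inter> h"
      using 2(1) ef h by blast
    then have fh: "f \<inter> h = {a}"
      using 1(2)[OF ef(1)] by (metis card_1_singletonE singletonD)
    have "card (e \<union> g) \<le> 6"
      using card_Un_le[of e g] tri ef g by simp
    moreover have "f \<union> h \<subseteq> e \<union> g"
      using 2(3) ef(2) h(1) by simp
    then have "a \<in> X \<and> X \<subseteq> e \<union> g" if "X \<in> F1 \<union> F2" for X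
      using that 1(1,3)[of X] 2(1,3)[of X] unfolding fh a by blast
    moreover have "a \<in> V"
      using a ef F1 by (auto simp: nsets_def)
    moreover have "finite (e \<union> g)"
      using tri ef g by simp
    ultimately show thesis
      by (intro star[of a "e \<union> g"])
  qed
qed

lemma ex_bij_betw_swap:
  assumes "finite V" "T \<subseteq> V" "T' \<subseteq> V" "card T = card T'"
  obtains \<sigma> where "bij_betw \<sigma> V V" "\<sigma> ` T = T'"
proof -
  have fin: "finite T" "finite T'"
    using assms finite_subset by blast+
  obtain g where g: "bij_betw g T T'"
    using fin assms(4) finite_same_card_bij by blast
  have "card (V - T) = card (V - T')"
    using assms fin by (simp add: card_Diff_subset)
  then obtain h where h: "bij_betw h (V - T) (V - T')"
    using assms(1) finite_same_card_bij by blast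
  let ?s = "\<lambda>v. if v \<in> T then g v else h v"
  have "bij_betw ?s T T'"
    using g bij_betw_cong[of T ?s g T'] by simp
  moreover have "bij_betw ?s (V - T) (V - T')"
    using h bij_betw_cong[of "V - T" ?s h "V - T'"] by simp
  ultimately have "bij_betw ?s (T \<union> (V - T)) (T' \<union> (V - T'))"
    by (rule bij_betw_combine) auto
  moreover have "T \<union> (V - T) = V" "T' \<union> (V - T') = V"
    using assms by auto
  ultimately have "bij_betw ?s V V"
    by simp
  moreover have "?s ` T = T'"
    using g by (simp add: bij_betw_def)
  ultimately show thesis
    by (rule that)
qed

text \<open>With a core \<open>T\<close>, a permutation moves \<open>T\<close> off itself; with a
  star, it moves the center out of the enclosing set, which is smaller than
  \<open>V\<close>.\<close>

lemma cross_close_families_displace: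
  assumes V: "finite V" "7 \<le> card V"
    and F1: "F1 \<subseteq> nsets V 3" "F1 \<noteq> {}" and F2: "F2 \<subseteq> nsets V 3" "F2 \<noteq> {}"
    and close: "\<And>X Y. \<lbrakk>X \<in> F1; Y \<in> F2\<rbrakk> \<Longrightarrow> 2 \<le> card (X \<inter> Y)"
  obtains \<sigma> where "bij_betw \<sigma> V V" "\<And>X. X \<in> F1 \<union> F2 \<Longrightarrow> \<sigma> ` X \<notin> F1 \<union> F2"
proof (rule cross_close_families[OF F1 F2 close])
  fix T assume core: "T \<in> nsets V 3" "\<And>X. X \<in> F1 \<union> F2 \<Longrightarrow> 2 \<le> card (X \<inter> T)"
  have T: "finite T" "T \<subseteq> V" "card T = 3"
    using core(1) by (auto simp: nsets_def)
  then have "3 \<le> card (V - T)"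
    using V by (simp add: card_Diff_subset)
  then obtain T' where T': "T' \<subseteq> V - T" "card T' = 3"
    by (rule obtain_subset_with_card_n)
  obtain \<sigma> where \<sigma>: "bij_betw \<sigma> V V" "\<sigma> ` T = T'"
    using ex_bij_betw_swap[of V T T'] V T T' by (metis Diff_subset subset_trans)
  have "\<sigma> ` X \<notin> F1 \<union> F2" if X: "X \<in> F1 \<union> F2" for X
  proof
    \<comment> \<open>The image of \<open>X\<close> would have two vertices in \<open>T'\<close>,
      coming from \<open>X \<inter> T\<close>, and two more in the disjoint set
      \<open>T\<close>.\<close>
    assume X': "\<sigma> ` X \<in> F1 \<union> F2"
    have inj: "inj_on \<sigma> V" and XV: "X \<subseteq> V" "finite (\<sigma> ` X)" and card3: "card (\<sigma> ` X) = 3"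
      using \<sigma>(1) X X' F1 F2 by (auto simp: bij_betw_def nsets_def)
    have "2 \<le> card (X \<inter> T)"
      using core(2) X by blast
    also have "card (X \<inter> T) = card (\<sigma> ` X \<inter> T')"
      using inj_on_image_Int[OF inj XV(1) T(2)] card_image[OF inj_on_subset[OF inj], of "X \<inter> T"] XV \<sigma>(2)
      by (simp add: le_infI1)
    finally have "2 \<le> card (\<sigma> ` X \<inter> T')" .
    moreover have "2 \<le> card (\<sigma> ` X \<inter> T)"
      using core(2) X' by blast
    moreover have "card (\<sigma> ` X \<inter> T') + card (\<sigma> ` X \<inter> T) = card (\<sigma> ` X \<inter> T' \<union> \<sigma> ` X \<inter> T)"
      using XV(2) T'(1) by (intro card_Un_disjoint[symmetric]) auto
    moreover have "\<dots> \<le> card (\<sigma> ` X)"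
      using XV(2) by (intro card_mono) auto
    ultimately show False
      using card3 by simp
  qed
  then show thesis
    using that \<sigma>(1) by blast
next
  fix a S assume star: "a \<in> V" "finite S" "card S \<le> 6" "\<And>X. X \<in> F1 \<union> F2 \<Longrightarrow> a \<in> X \<and> X \<subseteq> S"
  have "\<not> V \<subseteq> S"
    using V star(2,3) card_mono[of S V] by auto
  then obtain p where p: "p \<in> V" "p \<notin> S"
    by blast
  obtain \<sigma> where \<sigma>: "bij_betw \<sigma> V V" "\<sigma> ` {a} = {p}"
    using ex_bij_betw_swap[of V "{a}" "{p}"] V star(1) p(1) by auto
  \<comment> \<open>The image of \<open>X\<close> contains \<open>p\<close>, the new place of the
    center, but all members lie inside \<open>S\<close>.\<close>
  have "\<sigma> ` X \<notin> F1 \<union> F2" if "X \<in> F1 \<union> F2" for X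
    using star(4)[OF that] star(4)[of "\<sigma> ` X"] \<sigma>(2) p(2) by auto
  then show thesis
    using that \<sigma>(1) by blast
qed

section \<open>Copies of the loose path, and copies moved by a permutation\<close>

lemma has_rainbow_copy_if_rainbow_path:
  assumes "distinct [u, v, w, x, y, z, t]" "{u, v, w, x, y, z, t} \<subseteq> {..<n}"
    and "c {u, v, w} \<noteq> c {w, x, y}" "c {w, x, y} \<noteq> c {y, z, t}" "c {u, v, w} \<noteq> c {y, z, t}"
  shows "has_rainbow_copy c (K3 n) loose_path"
proof -
  \<comment> \<open>The shift by 1 matches the vertex numbers 1 to 7 with list positions 0 to
    6.\<close>
  define \<phi> where "\<phi> = (\<lambda>i. [u, v, w, x, y, z, t] ! (i - 1))"
  have vals: "\<phi> 1 = u" "\<phi> 2 = v" "\<phi> 3 = w" "\<phi> 4 = x" "\<phi> 5 = y" "\<phi> 6 = z" "\<phi> 7 = t"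
    by (simp_all add: \<phi>_def)
  have verts: "{1..7} = {1, 2, 3, 4, 5, 6, 7 :: nat}"
    by auto
  have img: "\<phi> ` {1, 2, 3} = {u, v, w}" "\<phi> ` {3, 4, 5} = {w, x, y}" "\<phi> ` {5, 6, 7} = {y, z, t}"
    by (simp_all only: image_insert image_empty vals)
  have "inj_on \<phi> {1..7}"
    unfolding verts using assms(1) vals by (auto simp: inj_on_def)
  moreover have "\<phi> ` {1..7} \<subseteq> {..<n}"
    unfolding verts using assms(2) vals by simp
  moreover have "\<forall>e\<in>{{1, 2, 3}, {3, 4, 5}, {5, 6, 7}}. \<phi> ` e \<in> nsets {..<n} 3"
    using assms(1,2) img by (simp add: nsets_def)
  ultimately have "embedding \<phi> loose_path (K3 n)"
    by (simp add: embedding_def loose_path_def K3_def)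
  moreover have "inj_on (\<lambda>e. c (\<phi> ` e)) {{1, 2, 3}, {3, 4, 5}, {5, 6, 7}}"
    unfolding inj_on_def using assms(3-5) img by auto
  ultimately show ?thesis
    unfolding has_rainbow_copy_def by (auto simp: loose_path_def)
qed

lemma not_has_rainbow_copy_if_two_colors:
  fixes c :: "nat set \<Rightarrow> nat"
  assumes "c ` edges (K3 n) \<subseteq> {0, 1}"
  shows "\<not> has_rainbow_copy c (K3 n) loose_path"
proof
  assume "has_rainbow_copy c (K3 n) loose_path"
  then obtain \<phi> where \<phi>: "embedding \<phi> loose_path (K3 n)"
    and inj: "inj_on (\<lambda>e. c (\<phi> ` e)) (edges loose_path)"
    unfolding has_rainbow_copy_def by blast
  have "(\<lambda>e. c (\<phi> ` e)) ` edges loose_path \<subseteq> {0, 1}"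
    using \<phi> assms by (auto simp: embedding_def image_subset_iff)
  then have "card (edges loose_path) \<le> card {0, 1 :: nat}"
    using inj by (intro card_inj_on_le) auto
  \<comment> \<open>The vertices 1 and 4 tell the three edges apart, so a rainbow copy would need
    three colors.\<close>
  moreover have "1 \<notin> {3, 4, 5 :: nat}" "1 \<notin> {5, 6, 7 :: nat}" "4 \<notin> {5, 6, 7 :: nat}"
    by auto
  then have "{1, 2, 3} \<noteq> {3, 4, 5 :: nat}" "{1, 2, 3} \<noteq> {5, 6, 7 :: nat}" "{3, 4, 5} \<noteq> {5, 6, 7 :: nat}"
    by blast+
  then have "card (edges loose_path) = 3"
    by (simp add: loose_path_def)
  ultimately show False
    by simp
qed

lemma embedding_comp_bij:
  assumes "embedding \<phi> H (K3 n)" "bij_betw \<sigma> {..<n} {..<n}"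
  shows "embedding (\<sigma> \<circ> \<phi>) H (K3 n)"
proof -
  have \<phi>: "inj_on \<phi> (verts H)" "\<phi> ` verts H \<subseteq> {..<n}" "\<forall>e\<in>edges H. \<phi> ` e \<in> nsets {..<n} 3"
    using assms(1) by (auto simp: embedding_def K3_def)
  have \<sigma>: "inj_on \<sigma> {..<n}" "\<sigma> ` {..<n} = {..<n}"
    using assms(2) by (auto simp: bij_betw_def)
  have "\<sigma> ` X \<in> nsets {..<n} 3" if "X \<in> nsets {..<n} 3" for X
    using that \<sigma> card_image[OF inj_on_subset[OF \<sigma>(1), of X]] by (auto simp: nsets_def)
  then have "\<forall>e\<in>edges H. (\<sigma> \<circ> \<phi>) ` e \<in> nsets {..<n} 3"
    using \<phi>(3) by (simp only: image_comp[symmetric]) blast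
  moreover have "(\<sigma> \<circ> \<phi>) ` verts H \<subseteq> {..<n}"
    using image_mono[OF \<phi>(2), of \<sigma>] \<sigma>(2) by (simp only: image_comp[symmetric])
  moreover have "inj_on (\<sigma> \<circ> \<phi>) (verts H)"
    using \<phi>(1,2) \<sigma>(1) by (blast intro: comp_inj_on inj_on_subset)
  ultimately show ?thesis
    by (simp add: embedding_def K3_def)
qed

section \<open>From two-colorings to any number of colors\<close>

lemma has_mono_copy_if_no_rainbow_path:
  fixes c :: "nat set \<Rightarrow> nat"
  assumes R: "\<And>d :: nat set \<Rightarrow> nat. d ` edges (K3 n) \<subseteq> {0, 1} \<Longrightarrow> has_mono_copy d (K3 n) H"
    and "7 \<le> n" and no: "\<not> has_rainbow_copy c (K3 n) loose_path"
  shows "has_mono_copy c (K3 n) H"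
proof -
  interpret rainbow_path_free "{..<n}" c
  proof
    fix u v w x y z t
    assume "distinct [u, v, w, x, y, z, t]" "{u, v, w, x, y, z, t} \<subseteq> {..<n}"
    then show "c {u, v, w} = c {w, x, y} \<or> c {w, x, y} = c {y, z, t} \<or> c {u, v, w} = c {y, z, t}"
      using has_rainbow_copy_if_rainbow_path[of u v w x y z t n c] no by argo
  qed (use \<open>7 \<le> n\<close> in auto)
  have edge: "edges (K3 n) = nsets {..<n} 3"
    by (simp add: K3_def)
  \<comment> \<open>All colors other than \<beta> are merged into one, and the two-color property
    yields a copy that is either entirely of color \<beta> or avoids it.\<close>
  have split: "\<exists>\<phi>. embedding \<phi> H (K3 n) \<and>
      ((\<forall>e\<in>edges H. c (\<phi> ` e) = \<beta>) \<or> (\<forall>e\<in>edges H. c (\<phi> ` e) \<noteq> \<beta>))" for \<beta>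
  proof -
    have "has_mono_copy (\<lambda>e. if c e = \<beta> then 0 else 1 :: nat) (K3 n) H"
      by (rule R) auto
    then obtain \<phi> k where "embedding \<phi> H (K3 n)" "\<forall>e\<in>edges H. (if c (\<phi> ` e) = \<beta> then 0 else 1 :: nat) = k"
      unfolding has_mono_copy_def by blast
    then show ?thesis
      by (intro exI[of _ \<phi>]) (metis zero_neq_one)
  qed
  have mem: "\<phi> ` e \<in> nsets {..<n} 3" if "embedding \<phi> H (K3 n)" "e \<in> edges H" for \<phi> e
    using that by (simp add: embedding_def edge)
  show ?thesis
  proof (cases "\<exists>X\<in>nsets {..<n} 3. \<exists>Y\<in>nsets {..<n} 3. \<exists>Z\<in>nsets {..<n} 3. c X \<noteq> c Y \<and> c X \<noteq> c Z \<and> c Y \<noteq> c Z")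
    case False
    \<comment> \<open>Without three different colors, two values cover all triples; a copy avoiding
      \<beta> then has color \<alpha> throughout.\<close>
    have "\<exists>\<alpha> \<beta>. \<forall>X\<in>nsets {..<n} 3. c X = \<alpha> \<or> c X = \<beta>"
      using False by metis
    then obtain \<alpha> \<beta> where two: "\<And>X. X \<in> nsets {..<n} 3 \<Longrightarrow> c X = \<alpha> \<or> c X = \<beta>"
      by blast
    obtain \<phi> where \<phi>: "embedding \<phi> H (K3 n)"
      "(\<forall>e\<in>edges H. c (\<phi> ` e) = \<beta>) \<or> (\<forall>e\<in>edges H. c (\<phi> ` e) \<noteq> \<beta>)"
      using split by blast
    then have "(\<forall>e\<in>edges H. c (\<phi> ` e) = \<beta>) \<or> (\<forall>e\<in>edges H. c (\<phi> ` e) = \<alpha>)"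
      using two mem by blast
    then show ?thesis
      using \<phi>(1) unfolding has_mono_copy_def by blast
  next
    case True
    then obtain X Y Z where "X \<in> nsets {..<n} 3" "Y \<in> nsets {..<n} 3" "Z \<in> nsets {..<n} 3"
      "c X \<noteq> c Y" "c X \<noteq> c Z" "c Y \<noteq> c Z"
      by blast
    then obtain \<alpha> \<beta> where str: "\<exists>X \<in> nsets {..<n} 3. c X = \<alpha>" "\<exists>Y \<in> nsets {..<n} 3. c Y \<notin> {\<alpha>, \<beta>}" "\<alpha> \<noteq> \<beta>"
      and close: "\<And>X Y. \<lbrakk>X \<in> nsets {..<n} 3; Y \<in> nsets {..<n} 3; c X = \<alpha>; c Y \<notin> {\<alpha>, \<beta>}\<rbrakk> \<Longrightarrow> 2 \<le> card (X \<inter> Y)"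
      by (rule color_structure) blast
    \<comment> \<open>As \<alpha> and \<beta> differ, the union of the two families consists of
      exactly the triples not colored \<beta>. Leaving the union therefore means entering color
      \<beta>.\<close>
    let ?F1 = "{X \<in> nsets {..<n} 3. c X = \<alpha>}" and ?F2 = "{Y \<in> nsets {..<n} 3. c Y \<notin> {\<alpha>, \<beta>}}"
    obtain \<sigma> where \<sigma>: "bij_betw \<sigma> {..<n} {..<n}" "\<And>X. X \<in> ?F1 \<union> ?F2 \<Longrightarrow> \<sigma> ` X \<notin> ?F1 \<union> ?F2"
    proof (rule cross_close_families_displace[of "{..<n}" ?F1 ?F2])
      show "finite {..<n}" "7 \<le> card {..<n}" "?F1 \<subseteq> nsets {..<n} 3" "?F2 \<subseteq> nsets {..<n} 3"
        using \<open>7 \<le> n\<close> by auto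
      show "?F1 \<noteq> {}" "?F2 \<noteq> {}"
        using str by blast+
      show "2 \<le> card (X \<inter> Y)" if "X \<in> ?F1" "Y \<in> ?F2" for X Y
        using close that by blast
    qed blast
    obtain \<phi> where \<phi>: "embedding \<phi> H (K3 n)"
      "(\<forall>e\<in>edges H. c (\<phi> ` e) = \<beta>) \<or> (\<forall>e\<in>edges H. c (\<phi> ` e) \<noteq> \<beta>)"
      using split by blast
    from \<phi>(2) show ?thesis
    proof
      assume "\<forall>e\<in>edges H. c (\<phi> ` e) = \<beta>"
      then show ?thesis
        using \<phi>(1) unfolding has_mono_copy_def by blast
    next
      assume ne: "\<forall>e\<in>edges H. c (\<phi> ` e) \<noteq> \<beta>"
      have emb: "embedding (\<sigma> \<circ> \<phi>) H (K3 n)"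
        using \<phi>(1) \<sigma>(1) by (rule embedding_comp_bij)
      have "c ((\<sigma> \<circ> \<phi>) ` e) = \<beta>" if "e \<in> edges H" for e
      proof -
        have "\<phi> ` e \<in> ?F1 \<union> ?F2"
          using mem[OF \<phi>(1) that] ne that by auto
        then have "(\<sigma> \<circ> \<phi>) ` e \<notin> ?F1 \<union> ?F2"
          using \<sigma>(2)[of "\<phi> ` e"] unfolding image_comp by blast
        then show ?thesis
          using mem[OF emb that] by blast
      qed
      then show ?thesis
        using emb unfolding has_mono_copy_def by blast
    qed
  qed
qed

theorem theorem1p10:
  fixes H :: "'a hypergraph"
  assumes "three_graph H"
    and "R2 H \<ge> max (enat (card (verts H) + 1)) 7"
  shows "constrained_ramsey H loose_path = R2 H"
proof -
  have "has_mono_copy c (K3 n) H \<or> has_rainbow_copy c (K3 n) loose_path"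
    if n: "\<forall>c :: nat set \<Rightarrow> nat. c ` edges (K3 n) \<subseteq> {0, 1} \<longrightarrow> has_mono_copy c (K3 n) H"
    for n and c :: "nat set \<Rightarrow> nat"
  proof -
    \<comment> \<open>Every such \<open>n\<close> is at least the infimum \<open>R2 H\<close>, which
      is how the lower bound 7 on \<open>R2 H\<close> becomes one on \<open>n\<close>.\<close>
    have "R2 H \<le> enat n"
      unfolding R2_def using n by (intro Inf_lower) blast
    with assms(2) have "7 \<le> enat n"
      by (meson max.boundedE order_trans)
    then have "7 \<le> n"
      by (simp add: numeral_eq_enat)
    then show ?thesis
      using has_mono_copy_if_no_rainbow_path[of n H c] n by blast
  qed
  \<comment> \<open>Both infima range over the same set. For the other inclusion, a two-coloring has
    no rainbow loose path, so the disjunction yields a monochromatic copy.\<close>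
  then have "{n. \<forall>c :: nat set \<Rightarrow> nat. has_mono_copy c (K3 n) H \<or> has_rainbow_copy c (K3 n) loose_path}
    = {n. \<forall>c :: nat set \<Rightarrow> nat. c ` edges (K3 n) \<subseteq> {0, 1} \<longrightarrow> has_mono_copy c (K3 n) H}"
    using not_has_rainbow_copy_if_two_colors by (intro Collect_cong) metis
  then show ?thesis
    unfolding constrained_ramsey_def R2_def by simp
qed

end
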